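(* There are normalized absolute norms $\|\cdot\|$ on $\mathbb{R}^2$ such that the real Banach space $X=(\mathbb{R}^2,\|\cdot\|)$ satisfies $n^{(3)}(X)=0$ and such that, for every positive number $\ell$, the function $(x,y)\longmapsto\|(x,y)\|^{\ell}$ is not a polynomial on $\mathbb{R}^2$.
   Context: A norm $\|\cdot\|$ on $\mathbb{R}^2$ is absolute if $\|(x,y)\|=\|(|x|,|y|)\|$ for all $x,y\in\mathbb{R}$, and normalized if $\|(1,0)\|=\|(0,1)\|=1$. For a Banach space $X$, let $S_X$ be its unit sphere, $B_X$ its closed unit ball, $X^*$ its dual, and $\Pi(X)=\{(x,x^* )\in S_X\times S_{X^*} : x^*(x)=1\}$. A continuous $k$-homogeneous polynomial on $X$ is a map $P:X\to X$ of the form $P(x)=A(x,\ldots,x)$ with $A:X\times\cdots\times X\to X$ a continuous $k$-linear map; $\mathcal{P}(^kX;X)$ is the space of all of them, normed by $\|P\|=\sup\{\|P(x)\| : x\in B_X\}$. The numerical radius of $P$ is $v(P)=\sup\{|x^*(P(x))| : (x,x^* )\in\Pi(X)\}$. The polynomial numerical index of order $k$ of $X$ is $n^{(k)}(X)=\inf\{v(P) : P\in\mathcal{P}(^kX;X),\ \|P\|=1\}$. *)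

theory Defs
  imports "HOL-Analysis.Analysis"
begin

text \<open>
  The norm of the space is an explicit function \<open>N\<close>, since the theorem quantifies over norms
  on a fixed vector space. Topological notions refer to the topology induced by \<open>N\<close>, not to
  the one coming from the type class of the underlying type. All suprema and infima below are
  real-valued: by continuity the sets are bounded, and they are nonempty for nontrivial spaces.
\<close>

definition is_norm :: "('a::real_vector \<Rightarrow> real) \<Rightarrow> bool" where
  "is_norm N \<longleftrightarrow>
     (\<forall>x. 0 \<le> N x) \<and>
     (\<forall>x. N x = 0 \<longleftrightarrow> x = 0) \<and>
     (\<forall>c x. N (c *\<^sub>R x) = \<bar>c\<bar> * N x) \<and>
     (\<forall>x y. N (x + y) \<le> N x + N y)"

definition absolute_norm :: "(real \<times> real \<Rightarrow> real) \<Rightarrow> bool" where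
  "absolute_norm N \<longleftrightarrow> is_norm N \<and> (\<forall>x y. N (x, y) = N (\<bar>x\<bar>, \<bar>y\<bar>))"

definition normalized_norm :: "(real \<times> real \<Rightarrow> real) \<Rightarrow> bool" where
  "normalized_norm N \<longleftrightarrow> is_norm N \<and> N (1, 0) = 1 \<and> N (0, 1) = 1"

definition norm_topology :: "('a::real_vector \<Rightarrow> real) \<Rightarrow> 'a topology" where
  "norm_topology N = Metric_space.mtopology UNIV (\<lambda>x y. N (x - y))"

definition dual_space :: "('a::real_vector \<Rightarrow> real) \<Rightarrow> ('a \<Rightarrow> real) set" where
  "dual_space N = {f. linear f \<and> continuous_map (norm_topology N) euclideanreal f}"

definition dual_norm :: "('a::real_vector \<Rightarrow> real) \<Rightarrow> ('a \<Rightarrow> real) \<Rightarrow> real" where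
  "dual_norm N f = (SUP x\<in>{x. N x \<le> 1}. \<bar>f x\<bar>)"

definition state_pairs :: "('a::real_vector \<Rightarrow> real) \<Rightarrow> ('a \<times> ('a \<Rightarrow> real)) set" where
  "state_pairs N = {(x, f). N x = 1 \<and> f \<in> dual_space N \<and> dual_norm N f = 1 \<and> f x = 1}"

text \<open>
  Elements of \<open>X\<^sup>k\<close> are functions on \<open>{..<k}\<close>, extended by \<open>undefined\<close> outside (the carrier of
  \<^const>\<open>product_topology\<close>).
\<close>

definition k_linear :: "nat \<Rightarrow> ((nat \<Rightarrow> 'a::real_vector) \<Rightarrow> 'b::real_vector) \<Rightarrow> bool" where
  "k_linear k A \<longleftrightarrow>
     (\<forall>v \<in> extensional {..<k}. \<forall>i<k. linear (\<lambda>x. A (v(i := x))))"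

definition hom_polys :: "nat \<Rightarrow> ('a::real_vector \<Rightarrow> real) \<Rightarrow> ('a \<Rightarrow> 'a) set" where
  "hom_polys k N =
     {P. \<exists>A. k_linear k A \<and>
             continuous_map (product_topology (\<lambda>_. norm_topology N) {..<k}) (norm_topology N) A \<and>
             (\<forall>x. P x = A (\<lambda>i\<in>{..<k}. x))}"

definition poly_norm :: "('a::real_vector \<Rightarrow> real) \<Rightarrow> ('a \<Rightarrow> 'a) \<Rightarrow> real" where
  "poly_norm N P = (SUP x\<in>{x. N x \<le> 1}. N (P x))"

definition numerical_radius :: "('a::real_vector \<Rightarrow> real) \<Rightarrow> ('a \<Rightarrow> 'a) \<Rightarrow> real" where
  "numerical_radius N P = (SUP (x, f)\<in>state_pairs N. \<bar>f (P x)\<bar>)"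

definition poly_numerical_index :: "nat \<Rightarrow> ('a::real_vector \<Rightarrow> real) \<Rightarrow> real" where
  "poly_numerical_index k N =
     (INF P\<in>{P \<in> hom_polys k N. poly_norm N P = 1}. numerical_radius N P)"

end

theory Submission
  imports Defs "HOL-Computational_Algebra.Polynomial"
begin

text \<open>
  A nonzero cubic field \<open>P\<close> has numerical radius 0 as soon as it is tangent to the unit sphere, i.e.
  as soon as the norm is a first integral of \<open>P\<close>. In the variables \<open>u = x\<^sup>2\<close>, \<open>v = y\<^sup>2\<close>, the field
  \<open>(y (2 e x\<^sup>2 + y\<^sup>2), - e\<^sup>2 x\<^sup>3)\<close> is \<open>2 x y\<close> times a linear field with a double eigenvalue,
  and its first integral of degree 1 is \<open>D exp (- e u / D)\<close> with \<open>D = e u + v\<close>. By the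
  convexity of \<open>exp\<close> this is the maximum over \<open>t \<ge> 0\<close> of the quadratic forms
  \<open>exp (- t) (t e x\<^sup>2 + (1 + t) y\<^sup>2)\<close>, so its square root is a norm. The factor
  \<open>exp (- e u / D)\<close> has an essential singularity on \<open>D = 0\<close>, so no power of the norm is a
  polynomial.
\<close>

definition gauge_quad :: "real \<times> real \<Rightarrow> real" where
  "gauge_quad z = exp 1 * (fst z)\<^sup>2 + (snd z)\<^sup>2"

text \<open>This is the square root of the first integral, with \<open>gauge_quad\<close> as
  \<open>D\<close>. The coefficient \<open>exp 1\<close> normalizes it: at \<open>(1, 0)\<close> the
  exponent is -1, which cancels that factor. At the origin the default value of 0 / 0 is harmless,
  since the first factor is 0.\<close>

definition exp_norm :: "real \<times> real \<Rightarrow> real" where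
  "exp_norm z = sqrt (gauge_quad z * exp (- (exp 1 * (fst z)\<^sup>2 / gauge_quad z)))"

definition tangent_field :: "real \<times> real \<Rightarrow> real \<times> real" where
  "tangent_field z =
     (snd z * (2 * exp 1 * (fst z)\<^sup>2 + (snd z)\<^sup>2), - ((exp 1)\<^sup>2 * (fst z) ^ 3))"

section \<open>Norm axioms for \<open>exp_norm\<close>\<close>

lemma gauge_quad_nonneg: "gauge_quad z \<ge> 0"
  by (simp add: gauge_quad_def)

lemma gauge_quad_eq_0_iff: "gauge_quad z = 0 \<longleftrightarrow> z = 0"
proof -
  have "gauge_quad z = 0 \<longleftrightarrow> exp 1 * (fst z)\<^sup>2 = 0 \<and> (snd z)\<^sup>2 = 0"
    unfolding gauge_quad_def by (intro add_nonneg_eq_0_iff) auto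
  then show ?thesis
    by (auto simp: prod_eq_iff)
qed

lemma gauge_quad_pos: "z \<noteq> 0 \<Longrightarrow> gauge_quad z > 0"
  using gauge_quad_nonneg[of z] gauge_quad_eq_0_iff[of z] by linarith

lemma exp_norm_squared:
  "(exp_norm z)\<^sup>2 = gauge_quad z * exp (- (exp 1 * (fst z)\<^sup>2 / gauge_quad z))"
  by (simp add: exp_norm_def gauge_quad_nonneg)

lemma exp_norm_nonneg: "exp_norm z \<ge> 0"
  by (simp add: exp_norm_def gauge_quad_nonneg)

lemma exp_norm_eq_0_iff: "exp_norm z = 0 \<longleftrightarrow> z = 0"
  by (simp add: exp_norm_def gauge_quad_eq_0_iff)

lemma exp_norm_zero [simp]: "exp_norm 0 = 0"
  by (simp add: exp_norm_eq_0_iff)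

lemma exp_norm_scaleR: "exp_norm (c *\<^sub>R z) = \<bar>c\<bar> * exp_norm z"
proof -
  have q: "gauge_quad (c *\<^sub>R z) = c\<^sup>2 * gauge_quad z"
    by (simp add: gauge_quad_def power_mult_distrib algebra_simps)
  \<comment> \<open>The exponent is homogeneous of degree 0; only \<open>c = 0\<close> needs its own
    case.\<close>
  have "c\<^sup>2 * (exp 1 * (fst z)\<^sup>2) / (c\<^sup>2 * gauge_quad z) = exp 1 * (fst z)\<^sup>2 / gauge_quad z"
    if "c \<noteq> 0" using that by simp
  then show ?thesis
    by (cases "c = 0")
       (simp_all add: exp_norm_def q gauge_quad_eq_0_iff real_sqrt_mult power_mult_distrib mult.left_commute)
qed

text \<open>The left-hand side is the tangent line at \<open>t\<close> of the convex function \<open>s \<mapsto> exp (- s)\<close>,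
  evaluated at \<open>s = exp 1 * (fst z)\<^sup>2 / gauge_quad z\<close> and multiplied by \<^term>\<open>gauge_quad z\<close>.\<close>

lemma quadratic_minorant:
  "exp (- t) * (t * exp 1 * (fst z)\<^sup>2 + (1 + t) * (snd z)\<^sup>2) \<le> (exp_norm z)\<^sup>2"
proof (cases "z = 0")
  case True
  then show ?thesis by simp
next
  case False
  define q where "q = gauge_quad z"
  define s where "s = exp 1 * (fst z)\<^sup>2 / q"
  have q: "q > 0" using gauge_quad_pos False by (simp add: q_def)
  have "exp (- t) * (1 + (t - s)) \<le> exp (- t) * exp (t - s)"
    by (intro mult_left_mono exp_ge_add_one_self) auto
  also have "\<dots> = exp (- s)" by (simp flip: exp_add)
  finally have "q * (exp (- t) * (1 + (t - s))) \<le> q * exp (- s)"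
    using q by (intro mult_left_mono) auto
  moreover have "q * exp (- s) = (exp_norm z)\<^sup>2"
    by (simp add: exp_norm_squared s_def q_def)
  moreover have "q * s = exp 1 * (fst z)\<^sup>2" using q by (simp add: s_def)
  then have "q * (1 + (t - s)) = t * exp 1 * (fst z)\<^sup>2 + (1 + t) * (snd z)\<^sup>2"
    unfolding q_def gauge_quad_def by (simp add: algebra_simps)
  ultimately show ?thesis by (metis mult.left_commute)
qed

text \<open>At this \<open>t\<close> the tangent line is taken at the point of evaluation itself, so
  the convexity estimate becomes an equality.\<close>

lemma quadratic_minorant_attained:
  assumes "z \<noteq> 0"
  defines "t \<equiv> exp 1 * (fst z)\<^sup>2 / gauge_quad z"
  shows "(exp_norm z)\<^sup>2 = exp (- t) * (t * exp 1 * (fst z)\<^sup>2 + (1 + t) * (snd z)\<^sup>2)"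
proof -
  have "gauge_quad z > 0" using gauge_quad_pos assms by simp
  then have "t * gauge_quad z = exp 1 * (fst z)\<^sup>2" by (simp add: t_def)
  then have "t * exp 1 * (fst z)\<^sup>2 + (1 + t) * (snd z)\<^sup>2 = gauge_quad z"
    unfolding gauge_quad_def by (simp add: algebra_simps)
  then show ?thesis by (simp add: exp_norm_squared t_def)
qed

text \<open>For fixed \<open>t \<ge> 0\<close> the minorant is the square of the Euclidean seminorm
  \<open>norm (T p)\<close>. With \<open>t\<close> chosen for \<open>z + w\<close>, it agrees with
  \<open>exp_norm\<close> at the sum and lies below it at \<open>z\<close> and \<open>w\<close>, so
  the Euclidean triangle inequality suffices.\<close>

lemma exp_norm_triangle: "exp_norm (z + w) \<le> exp_norm z + exp_norm w"
proof (cases "z + w = 0")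
  case True
  then show ?thesis
    using exp_norm_nonneg[of z] exp_norm_nonneg[of w] by simp
next
  case False
  define t where "t = exp 1 * (fst (z + w))\<^sup>2 / gauge_quad (z + w)"
  have t: "t \<ge> 0" by (simp add: t_def gauge_quad_nonneg)
  define T :: "real \<times> real \<Rightarrow> real \<times> real" where
    "T p = (sqrt (exp (- t) * t * exp 1) * fst p, sqrt (exp (- t) * (1 + t)) * snd p)" for p
  have normT: "(norm (T p))\<^sup>2 = exp (- t) * (t * exp 1 * (fst p)\<^sup>2 + (1 + t) * (snd p)\<^sup>2)" for p
    using t by (simp add: T_def norm_Pair power_mult_distrib algebra_simps)
  have le: "norm (T p) \<le> exp_norm p" for p
    by (rule power2_le_imp_le) (simp_all only: normT quadratic_minorant exp_norm_nonneg)
  have "(exp_norm (z + w))\<^sup>2 = (norm (T (z + w)))\<^sup>2"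
    using quadratic_minorant_attained[OF False] by (simp add: normT t_def)
  then have "exp_norm (z + w) = norm (T (z + w))"
    by (simp add: exp_norm_nonneg)
  also have "T (z + w) = T z + T w"
    by (simp add: T_def algebra_simps)
  also have "norm (T z + T w) \<le> norm (T z) + norm (T w)"
    by (rule norm_triangle_ineq)
  finally show ?thesis using le[of z] le[of w] by linarith
qed

lemma is_norm_exp_norm: "is_norm exp_norm"
  by (simp add: is_norm_def exp_norm_nonneg exp_norm_eq_0_iff exp_norm_scaleR exp_norm_triangle)

section \<open>Comparison with the Euclidean norm and topology\<close>

lemma abs_fst_le_exp_norm: "\<bar>fst z\<bar> \<le> exp_norm z"
proof -
  \<comment> \<open>The minorant at \<open>t = 1\<close> has coefficient exactly 1 at the first
    square.\<close>
  have "(fst z)\<^sup>2 \<le> exp (- 1) * (1 * exp 1 * (fst z)\<^sup>2 + (1 + 1) * (snd z)\<^sup>2)"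
    by (simp add: distrib_left mult.assoc[symmetric] flip: exp_add)
  also have "\<dots> \<le> (exp_norm z)\<^sup>2" by (rule quadratic_minorant)
  finally show ?thesis by (simp add: abs_le_square_iff[symmetric] exp_norm_nonneg)
qed

lemma abs_snd_le_exp_norm: "\<bar>snd z\<bar> \<le> exp_norm z"
proof -
  have "(snd z)\<^sup>2 \<le> (exp_norm z)\<^sup>2" using quadratic_minorant[of 0 z] by simp
  then show ?thesis by (simp add: abs_le_square_iff[symmetric] exp_norm_nonneg)
qed

lemma exp_norm_le_norm: "exp_norm z \<le> sqrt (exp 1) * norm z"
proof (rule power2_le_imp_le)
  have "(exp_norm z)\<^sup>2 \<le> gauge_quad z * 1"
    unfolding exp_norm_squared by (intro mult_left_mono) (simp_all add: gauge_quad_nonneg)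
  also have "\<dots> \<le> exp 1 * ((fst z)\<^sup>2 + (snd z)\<^sup>2)"
    using mult_right_mono[of 1 "exp 1" "(snd z)\<^sup>2"]
    by (simp add: gauge_quad_def distrib_left)
  also have "\<dots> = (sqrt (exp 1) * norm z)\<^sup>2"
    by (simp add: power_mult_distrib norm_prod_def)
  finally show "(exp_norm z)\<^sup>2 \<le> (sqrt (exp 1) * norm z)\<^sup>2" .
qed simp

lemma norm_le_exp_norm: "norm z \<le> 2 * exp_norm z"
  using norm_Pair_le[of "fst z" "snd z"] abs_fst_le_exp_norm[of z] abs_snd_le_exp_norm[of z]
  by simp

lemma Metric_space_is_norm:
  assumes "is_norm N"
  shows "Metric_space UNIV (\<lambda>x y. N (x - y))"
proof
  have scale: "N (c *\<^sub>R x) = \<bar>c\<bar> * N x" and tri: "N (x + y) \<le> N x + N y" for c x y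
    using assms by (auto simp: is_norm_def)
  show "0 \<le> N (x - y)" and "N (x - y) = 0 \<longleftrightarrow> x = y" for x y
    using assms by (auto simp: is_norm_def)
  show "N (x - y) = N (y - x)" for x y
    using scale[of "- 1" "x - y"] by simp
  show "N (x - z) \<le> N (x - y) + N (y - z)" for x y z
    using tri[of "x - y" "y - z"] by simp
qed

text \<open>Equivalent norms have comparable balls. This lets the continuity conditions in
  \<open>dual_space\<close> and \<open>hom_polys\<close> be checked in the standard
  topology.\<close>

lemma norm_topology_eq_euclidean:
  fixes N :: "'a::real_normed_vector \<Rightarrow> real"
  assumes N: "is_norm N" and upper: "\<And>x. N x \<le> C * norm x" and lower: "\<And>x. norm x \<le> B * N x"
    and "C > 0" "B > 0"
  shows "norm_topology N = euclidean"
proof (rule topology_eq[THEN iffD2], intro allI)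
  fix U :: "'a set"
  interpret M: Metric_space UNIV "\<lambda>x y. N (x - y)"
    by (rule Metric_space_is_norm[OF N])
  have mball: "M.mball x r = {y. N (x - y) < r}" for x r
    by (auto simp: M.mball_def)
  have "(\<exists>r>0. {y. N (x - y) < r} \<subseteq> U) \<longleftrightarrow> (\<exists>e>0. ball x e \<subseteq> U)" for x
  proof
    assume "\<exists>r>0. {y. N (x - y) < r} \<subseteq> U"
    then obtain r where r: "r > 0" "{y. N (x - y) < r} \<subseteq> U" by blast
    have "N (x - y) < r" if "dist x y < r / C" for y
    proof -
      have "C * norm (x - y) < r"
        using that \<open>C > 0\<close> by (simp add: dist_norm field_simps)
      then show ?thesis using upper[of "x - y"] by linarith
    qed
    then have "ball x (r / C) \<subseteq> U" using r by auto
    then show "\<exists>e>0. ball x e \<subseteq> U" using r \<open>C > 0\<close> by (metis divide_pos_pos)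
  next
    assume "\<exists>e>0. ball x e \<subseteq> U"
    then obtain e where e: "e > 0" "ball x e \<subseteq> U" by blast
    have "dist x y < e" if "N (x - y) < e / B" for y
    proof -
      have "B * N (x - y) < e"
        using that \<open>B > 0\<close> by (simp add: field_simps)
      then show ?thesis using lower[of "x - y"] by (simp add: dist_norm)
    qed
    then have "{y. N (x - y) < e / B} \<subseteq> U" using e by auto
    then show "\<exists>r>0. {y. N (x - y) < r} \<subseteq> U" using e \<open>B > 0\<close> by (metis divide_pos_pos)
  qed
  then show "openin (norm_topology N) U = openin euclidean U"
    by (auto simp: norm_topology_def M.openin_mtopology mball open_contains_ball)
qed

lemma norm_topology_exp_norm: "norm_topology exp_norm = euclidean"
  by (rule norm_topology_eq_euclidean[OF is_norm_exp_norm exp_norm_le_norm norm_le_exp_norm]) auto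

section \<open>Linear functionals and tangency of the field\<close>

text \<open>Homogeneity extends the bound from the unit ball to all \<open>w\<close>. The real
  supremum is known to be an upper bound only once the set is bounded, which follows from
  boundedness of \<open>f\<close> for the Euclidean norm.\<close>

lemma linear_le_dual_norm:
  fixes f :: "real \<times> real \<Rightarrow> real"
  assumes f: "linear f"
  shows "\<bar>f w\<bar> \<le> dual_norm exp_norm f * exp_norm w"
proof (cases "w = 0")
  case True
  then show ?thesis using f by (simp add: linear_0)
next
  case False
  obtain B where B: "\<And>x. \<bar>f x\<bar> \<le> norm x * B" and "B > 0"
    using f by (metis bounded_linear.pos_bounded linear_conv_bounded_linear real_norm_def)
  have "\<bar>f x\<bar> \<le> 2 * B" if "exp_norm x \<le> 1" for x
  proof -
    have "norm x * B \<le> 2 * B"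
      using norm_le_exp_norm[of x] that \<open>B > 0\<close> by (intro mult_right_mono) auto
    then show ?thesis using B[of x] by linarith
  qed
  then have bdd: "bdd_above ((\<lambda>x. \<bar>f x\<bar>) ` {x. exp_norm x \<le> 1})"
    by (intro bdd_aboveI2) auto
  define r where "r = exp_norm w"
  have r: "r > 0" using False exp_norm_nonneg[of w] exp_norm_eq_0_iff[of w] by (simp add: r_def)
  have "exp_norm ((1 / r) *\<^sub>R w) \<le> 1" using r by (simp add: exp_norm_scaleR flip: r_def)
  then have "\<bar>f ((1 / r) *\<^sub>R w)\<bar> \<le> dual_norm exp_norm f"
    unfolding dual_norm_def by (intro cSUP_upper[OF _ bdd]) auto
  then show ?thesis
    using r f by (simp add: linear_cmul abs_mult field_simps flip: r_def)
qed

text \<open>Along the field, \<open>D\<close> has derivative \<open>2 * exp 1 * x * y * D\<close>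
  and the quotient in the exponent has derivative \<open>2 * exp 1 * x * y\<close>, so the two
  contributions to the logarithmic derivative cancel.\<close>

lemma exp_norm_squared_derivative_along_tangent_field:
  assumes "z \<noteq> 0"
  shows "((\<lambda>t. (exp_norm (z + t *\<^sub>R tangent_field z))\<^sup>2) has_real_derivative 0) (at 0)"
proof -
  obtain x y where z: "z = (x, y)" by (cases z)
  define a where "a = y * (2 * exp 1 * x\<^sup>2 + y\<^sup>2)"
  define b where "b = - ((exp 1)\<^sup>2 * x ^ 3)"
  define D where "D = exp 1 * x\<^sup>2 + y\<^sup>2"
  have D: "D > 0" using gauge_quad_pos[OF assms] by (simp add: gauge_quad_def D_def z)
  have key: "2 * exp 1 * x * a + 2 * y * b = 2 * exp 1 * x * y * D"
    unfolding a_def b_def D_def by algebra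
  have key2: "x * a = x * y * (D + exp 1 * x\<^sup>2)"
    unfolding a_def D_def by algebra
  define E where "E = exp (- (exp 1 * x\<^sup>2 / D))"
  define q where "q t = exp 1 * (x + t * a)\<^sup>2 + (y + t * b)\<^sup>2" for t
  have q0: "q 0 = D" by (simp add: q_def D_def)
  have dq: "(q has_real_derivative 2 * exp 1 * x * y * D) (at 0)"
    unfolding q_def by (rule derivative_eq_intros refl | use key in \<open>simp add: algebra_simps\<close>)+
  have ds: "((\<lambda>t. exp 1 * (x + t * a)\<^sup>2 / q t) has_real_derivative
      (2 * exp 1 * (x * a) * D - exp 1 * x\<^sup>2 * (2 * exp 1 * x * y * D)) / (D * D)) (at 0)"
    by (rule derivative_eq_intros dq refl | use D in \<open>simp add: q0\<close>)+
  have val: "(2 * exp 1 * (x * a) * D - exp 1 * x\<^sup>2 * (2 * exp 1 * x * y * D)) / (D * D)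
      = 2 * exp 1 * x * y"
  proof -
    have "2 * exp 1 * (x * a) * D - exp 1 * x\<^sup>2 * (2 * exp 1 * x * y * D) = 2 * exp 1 * x * y * (D * D)"
      unfolding key2 by algebra
    then show ?thesis using D by simp
  qed
  have ds': "((\<lambda>t. exp 1 * (x + t * a)\<^sup>2 / q t) has_real_derivative 2 * exp 1 * x * y) (at 0)"
    using ds unfolding val .
  have "((\<lambda>t. q t * exp (- (exp 1 * (x + t * a)\<^sup>2 / q t))) has_real_derivative 0) (at 0)"
    by (rule derivative_eq_intros dq ds' refl | simp add: q0)+
  moreover have "(exp_norm (z + t *\<^sub>R tangent_field z))\<^sup>2
      = q t * exp (- (exp 1 * (x + t * a)\<^sup>2 / q t))" for t
    by (simp add: exp_norm_squared gauge_quad_def tangent_field_def z q_def a_def b_def)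
  ultimately show ?thesis by simp
qed

text \<open>Since \<open>\<bar>f\<bar> \<le> N\<close> with equality at \<open>z\<close>, the function \<open>N\<^sup>2 - f\<^sup>2\<close> has a minimum at \<open>z\<close>, so its
  derivative in the direction of the field vanishes.\<close>

lemma state_vanishes_on_tangent_field:
  assumes "(z, f) \<in> state_pairs exp_norm"
  shows "f (tangent_field z) = 0"
proof -
  have z: "exp_norm z = 1" and lin: "linear f" and dual: "dual_norm exp_norm f = 1" and fz: "f z = 1"
    using assms by (auto simp: state_pairs_def dual_space_def)
  define c where "c = f (tangent_field z)"
  define h where "h t = (exp_norm (z + t *\<^sub>R tangent_field z))\<^sup>2 - (1 + t * c)\<^sup>2" for t
  have "z \<noteq> 0" using z exp_norm_eq_0_iff[of z] by auto
  note DERIV_diff[OF exp_norm_squared_derivative_along_tangent_field[OF this]]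
  moreover have "((\<lambda>t. (1 + t * c)\<^sup>2) has_real_derivative 2 * c) (at 0)"
    by (rule derivative_eq_intros refl | simp)+
  ultimately have "(h has_real_derivative 0 - 2 * c) (at 0)"
    unfolding h_def by blast
  moreover have "h 0 \<le> h t" for t
  proof -
    have "f (z + t *\<^sub>R tangent_field z) = 1 + t * c"
      using lin by (simp add: linear_add linear_cmul fz c_def)
    then have "\<bar>1 + t * c\<bar> \<le> exp_norm (z + t *\<^sub>R tangent_field z)"
      using linear_le_dual_norm[OF lin, of "z + t *\<^sub>R tangent_field z"] dual by simp
    then have "(1 + t * c)\<^sup>2 \<le> (exp_norm (z + t *\<^sub>R tangent_field z))\<^sup>2"
      by (simp add: abs_le_square_iff[symmetric] exp_norm_nonneg)
    then show ?thesis by (simp add: h_def z)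
  qed
  ultimately have "0 - 2 * c = 0"
    by (intro DERIV_local_min[of h _ 0 1]) auto
  then show ?thesis by (simp add: c_def)
qed

text \<open>The bound of the first coordinate by the norm makes \<open>fst\<close> a supporting
  functional at \<open>(1, 0)\<close>. This explicit pair shows that suprema over
  \<open>state_pairs\<close> do not range over the empty set.\<close>

lemma fst_state: "((1, 0), fst) \<in> state_pairs exp_norm"
proof -
  have one: "exp_norm (1, 0) = 1"
    by (simp add: exp_norm_def gauge_quad_def flip: exp_add)
  have "dual_norm exp_norm fst = 1"
    unfolding dual_norm_def
  proof (rule cSup_eq_maximum)
    show "1 \<in> (\<lambda>x. \<bar>fst x\<bar>) ` {x :: real \<times> real. exp_norm x \<le> 1}"
      using one by (intro image_eqI[of _ _ "(1, 0)"]) auto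
    show "a \<le> 1" if "a \<in> (\<lambda>x. \<bar>fst x\<bar>) ` {x :: real \<times> real. exp_norm x \<le> 1}" for a
      using that abs_fst_le_exp_norm order_trans by fastforce
  qed
  moreover have "continuous_map euclidean euclideanreal (fst :: real \<times> real \<Rightarrow> real)"
    by (simp add: continuous_on_fst continuous_on_id)
  ultimately show ?thesis
    by (simp add: state_pairs_def dual_space_def norm_topology_exp_norm one linear_fst)
qed

section \<open>Cubic homogeneous polynomials and the index of order 3\<close>

text \<open>The trilinear map is expanded slot by slot; \<open>b\<close> and \<open>c\<close> each
  collect three of its values, which may differ.\<close>

lemma hom_polys_3_expand:
  assumes "P \<in> hom_polys 3 N"
  obtains a b c d :: "'a::real_vector"
  where "\<And>s t. P (s *\<^sub>R u + t *\<^sub>R v) = (s ^ 3) *\<^sub>R a + (s\<^sup>2 * t) *\<^sub>R b + (s * t\<^sup>2) *\<^sub>R c + (t ^ 3) *\<^sub>R d"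
proof -
  obtain A where lin: "k_linear 3 A" and P: "\<And>x. P x = A (\<lambda>i\<in>{..<3}. x)"
    using assms by (auto simp: hom_polys_def)
  \<comment> \<open>The restriction to \<open>{..<3}\<close> is there because
    \<open>k_linear\<close> speaks of \<open>extensional\<close> tuples only.\<close>
  define V :: "'a \<Rightarrow> 'a \<Rightarrow> 'a \<Rightarrow> nat \<Rightarrow> 'a" where
    "V p q r = (\<lambda>i\<in>{..<3}. if i = 0 then p else if i = 1 then q else r)" for p q r
  define B where "B p q r = A (V p q r)" for p q r
  have ext: "V p q r \<in> extensional {..<3}" for p q r by (simp add: V_def)
  have L: "linear (\<lambda>x. A ((V p q r)(i := x)))" if "i < 3" for p q r i
    using lin ext that by (auto simp: k_linear_def)
  have "(V p q r)(0 := x) = V x q r" "(V p q r)(1 := x) = V p x r" "(V p q r)(2 := x) = V p q x"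
    for p q r x
    by (auto simp: V_def fun_eq_iff restrict_def)
  then have lins: "linear (\<lambda>x. B x q r)" "linear (\<lambda>x. B p x r)" "linear (\<lambda>x. B p q x)" for p q r
    using L[of 0 p q r] L[of 1 p q r] L[of 2 p q r] by (simp_all add: B_def)
  have PB: "P x = B x x x" for x
    unfolding P B_def V_def by (rule arg_cong[of _ _ A]) auto
  have B1: "B (s *\<^sub>R p + t *\<^sub>R p') q r = s *\<^sub>R B p q r + t *\<^sub>R B p' q r" for s t p p' q r
    by (simp add: linear_add[OF lins(1)] linear_cmul[OF lins(1)])
  have B2: "B p (s *\<^sub>R q + t *\<^sub>R q') r = s *\<^sub>R B p q r + t *\<^sub>R B p q' r" for s t p q q' r
    by (simp add: linear_add[OF lins(2)] linear_cmul[OF lins(2)])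
  have B3: "B p q (s *\<^sub>R r + t *\<^sub>R r') = s *\<^sub>R B p q r + t *\<^sub>R B p q r'" for s t p q r r'
    by (simp add: linear_add[OF lins(3)] linear_cmul[OF lins(3)])
  have "P (s *\<^sub>R u + t *\<^sub>R v) = (s ^ 3) *\<^sub>R B u u u + (s\<^sup>2 * t) *\<^sub>R (B u u v + B u v u + B v u u)
      + (s * t\<^sup>2) *\<^sub>R (B u v v + B v u v + B v v u) + (t ^ 3) *\<^sub>R B v v v" for s t
    unfolding PB B1 B2 B3
    by (simp add: scaleR_add_right power2_eq_square power3_eq_cube ac_simps)
  then show ?thesis by (rule that)
qed

text \<open>On the unit ball both coordinates are at most 1 in absolute value, hence so are the four
  monomials of the expansion. This makes the supremum in \<open>poly_norm\<close> a genuine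
  one.\<close>

lemma hom_poly_3_bounded:
  assumes "P \<in> hom_polys 3 exp_norm"
  shows "bdd_above ((\<lambda>x. exp_norm (P x)) ` {x. exp_norm x \<le> 1})"
proof -
  obtain a b c d where P: "\<And>s t. P (s *\<^sub>R (1, 0) + t *\<^sub>R (0, 1))
      = (s ^ 3) *\<^sub>R a + (s\<^sup>2 * t) *\<^sub>R b + (s * t\<^sup>2) *\<^sub>R c + (t ^ 3) *\<^sub>R d"
    using hom_polys_3_expand[OF assms] by blast
  have sc: "exp_norm (k *\<^sub>R p) \<le> exp_norm p" if "\<bar>k\<bar> \<le> 1" for k p
    using that exp_norm_nonneg[of p] by (simp add: exp_norm_scaleR mult_left_le_one_le)
  have "exp_norm (P x) \<le> exp_norm a + exp_norm b + exp_norm c + exp_norm d"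
    if "exp_norm x \<le> 1" for x
  proof -
    define s where "s = fst x"
    define t where "t = snd x"
    have s: "\<bar>s\<bar> \<le> 1" and t: "\<bar>t\<bar> \<le> 1"
      using that abs_fst_le_exp_norm[of x] abs_snd_le_exp_norm[of x] by (auto simp: s_def t_def)
    have "\<bar>s\<bar> ^ i * \<bar>t\<bar> ^ j \<le> 1" for i j
      using s t by (intro mult_le_one power_le_one) auto
    from this[of 3 0] this[of 2 1] this[of 1 2] this[of 0 3]
    have "\<bar>s ^ 3\<bar> \<le> 1" "\<bar>s\<^sup>2 * t\<bar> \<le> 1" "\<bar>s * t\<^sup>2\<bar> \<le> 1" "\<bar>t ^ 3\<bar> \<le> 1"
      by (simp_all add: abs_mult power_abs)
    note bounds = this[THEN sc]
    have "x = s *\<^sub>R (1, 0) + t *\<^sub>R (0, 1)" by (simp add: s_def t_def)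
    then have "P x = (s ^ 3) *\<^sub>R a + (s\<^sup>2 * t) *\<^sub>R b + (s * t\<^sup>2) *\<^sub>R c + (t ^ 3) *\<^sub>R d"
      using P by metis
    also have "exp_norm \<dots> \<le> exp_norm ((s ^ 3) *\<^sub>R a) + exp_norm ((s\<^sup>2 * t) *\<^sub>R b)
        + exp_norm ((s * t\<^sup>2) *\<^sub>R c) + exp_norm ((t ^ 3) *\<^sub>R d)"
      by (intro order_trans[OF exp_norm_triangle] add_right_mono exp_norm_triangle order_refl)
    finally show ?thesis using bounds[of a] bounds[of b] bounds[of c] bounds[of d] by linarith
  qed
  then show ?thesis by (intro bdd_aboveI2) auto
qed

text \<open>To compare the real supremum with one of its terms, the set must be bounded:
  \<open>f\<close> has dual norm 1, so its value at \<open>P z\<close> is at most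
  \<open>exp_norm (P z)\<close>. The pair from \<open>fst_state\<close> then gives a nonnegative
  term.\<close>

lemma numerical_radius_nonneg:
  assumes P: "P \<in> hom_polys 3 exp_norm"
  shows "numerical_radius exp_norm P \<ge> 0"
proof -
  obtain K where K: "\<And>x. exp_norm x \<le> 1 \<Longrightarrow> exp_norm (P x) \<le> K"
    using hom_poly_3_bounded[OF P] by (auto simp: bdd_above_def)
  have "\<bar>f (P z)\<bar> \<le> K" if "(z, f) \<in> state_pairs exp_norm" for z f
    using that linear_le_dual_norm[of f "P z"] K[of z]
    by (auto simp: state_pairs_def dual_space_def)
  then have "bdd_above ((\<lambda>(z, f). \<bar>f (P z)\<bar>) ` state_pairs exp_norm)"
    by (intro bdd_aboveI2[where M = K]) auto
  then have "\<bar>fst (P (1, 0))\<bar> \<le> numerical_radius exp_norm P"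
    unfolding numerical_radius_def by (rule cSUP_upper2[OF _ fst_state]) auto
  then show ?thesis by linarith
qed

lemma scaled_tangent_field_hom_poly:
  "(\<lambda>z. c *\<^sub>R tangent_field z) \<in> hom_polys 3 exp_norm"
proof -
  define A :: "(nat \<Rightarrow> real \<times> real) \<Rightarrow> real \<times> real" where
    \<comment> \<open>An asymmetric trilinear map with the right diagonal: in the monomial
      \<open>x\<^sup>2 y\<close> slot 0 carries \<open>y\<close>.\<close>
    "A v = c *\<^sub>R (2 * exp 1 * (snd (v 0) * fst (v 1) * fst (v 2)) + snd (v 0) * snd (v 1) * snd (v 2),
             - ((exp 1)\<^sup>2 * (fst (v 0) * fst (v 1) * fst (v 2))))" for v
  have lin: "linear (\<lambda>x. A (v(i := x)))" if "i < 3" for v i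
  proof -
    have "i = 0 \<or> i = 1 \<or> i = 2" using that by auto
    then show ?thesis
      by (elim disjE; intro linearI) (simp_all add: A_def algebra_simps)
  qed
  let ?T = "product_topology (\<lambda>_. euclidean :: (real \<times> real) topology) {..<3::nat}"
  have proj: "continuous_map ?T euclidean (\<lambda>v. v i)" if "i < 3" for i
    using that by (intro continuous_map_product_projection) auto
  have f: "continuous_map ?T euclideanreal (\<lambda>v. fst (v i))"
    and s: "continuous_map ?T euclideanreal (\<lambda>v. snd (v i))" if "i < 3" for i
    using continuous_map_compose[OF proj[OF that], of euclideanreal fst]
      continuous_map_compose[OF proj[OF that], of euclideanreal snd]
    by (simp_all add: o_def continuous_on_fst continuous_on_snd continuous_on_id)
  have "continuous_map ?T (prod_topology euclideanreal euclideanreal) A"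
    unfolding A_def scaleR_Pair real_scaleR_def
    by (intro continuous_map_pairedI continuous_map_real_mult continuous_map_add
        continuous_map_minus f s continuous_map_const[THEN iffD2]) auto
  then have "continuous_map ?T euclidean A" by (simp add: euclidean_product_topology)
  moreover have "c *\<^sub>R tangent_field z = A (\<lambda>i\<in>{..<3}. z)" for z
    by (simp add: A_def tangent_field_def power2_eq_square power3_eq_cube algebra_simps)
  ultimately show ?thesis
    using lin unfolding hom_polys_def norm_topology_exp_norm k_linear_def by blast
qed

lemma poly_norm_scaleR:
  assumes N: "is_norm N" and bdd: "bdd_above ((\<lambda>x. N (P x)) ` {x. N x \<le> 1})"
  shows "poly_norm N (\<lambda>x. c *\<^sub>R P x) = \<bar>c\<bar> * poly_norm N P"
proof -
  have "N 0 = 0" using N by (simp add: is_norm_def)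
  then have ne: "{x. N x \<le> 1} \<noteq> {}" by (auto intro!: exI[of _ 0])
  have "\<bar>c\<bar> * (SUP x\<in>{x. N x \<le> 1}. N (P x)) = (SUP x\<in>{x. N x \<le> 1}. \<bar>c\<bar> * N (P x))"
    \<comment> \<open>Multiplication by \<open>\<bar>c\<bar>\<close> is monotone and continuous, so
      it passes through the supremum.\<close>
    using continuous_at_Sup_mono[of "(*) \<bar>c\<bar>", OF _ _ _ bdd] ne
    by (simp add: image_image monoI mult_left_mono continuous_intros)
  then show ?thesis using N by (simp add: poly_norm_def is_norm_def)
qed

text \<open>All numerical radii are nonnegative, and the tangent field, scaled to norm 1, has
  numerical radius 0, so the infimum is attained there.\<close>

lemma poly_numerical_index_exp_norm: "poly_numerical_index 3 exp_norm = 0"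
  unfolding poly_numerical_index_def
proof (rule cInf_eq_minimum)
  let ?\<P> = "{P \<in> hom_polys 3 exp_norm. poly_norm exp_norm P = 1}"
  show "0 \<le> r" if "r \<in> numerical_radius exp_norm ` ?\<P>" for r
    using that numerical_radius_nonneg by auto
  have T: "tangent_field \<in> hom_polys 3 exp_norm"
    using scaled_tangent_field_hom_poly[of 1] by simp
  define M where "M = poly_norm exp_norm tangent_field"
  \<comment> \<open>A nonzero value at one unit vector makes \<open>M\<close> positive, so the field
    can be normalized.\<close>
  have "exp_norm (tangent_field (1, 0)) \<le> M"
    unfolding M_def poly_norm_def using fst_state
    by (intro cSUP_upper[OF _ hom_poly_3_bounded[OF T]]) (auto simp: state_pairs_def)
  moreover have "tangent_field (1, 0) \<noteq> 0"
    by (simp add: tangent_field_def prod_eq_iff)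
  ultimately have M: "M > 0"
    using exp_norm_nonneg[of "tangent_field (1, 0)"] exp_norm_eq_0_iff[of "tangent_field (1, 0)"]
    by linarith
  define P where "P z = (1 / M) *\<^sub>R tangent_field z" for z
  have "poly_norm exp_norm P = 1"
    using poly_norm_scaleR[OF is_norm_exp_norm hom_poly_3_bounded[OF T], of "1 / M"] M
    unfolding P_def by (simp flip: M_def)
  then have P: "P \<in> ?\<P>"
    using scaled_tangent_field_hom_poly[of "1 / M"] by (simp add: P_def[abs_def])
  have "(\<lambda>(z, f). \<bar>f (P z)\<bar>) x = 0" if "x \<in> state_pairs exp_norm" for x
  proof -
    obtain z f where x: "x = (z, f)" by (cases x)
    then have "linear f" using that by (auto simp: state_pairs_def dual_space_def)
    then show ?thesis
      using state_vanishes_on_tangent_field[of z f] that x by (simp add: P_def linear_cmul)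
  qed
  then have "numerical_radius exp_norm P = (SUP x\<in>state_pairs exp_norm. 0)"
    unfolding numerical_radius_def by (intro SUP_cong) auto
  also have "\<dots> = 0" using fst_state by (intro cSUP_const) auto
  finally show "0 \<in> numerical_radius exp_norm ` ?\<P>"
    by (intro image_eqI[OF _ P]) simp
qed

section \<open>Powers of the norm are not polynomials\<close>

text \<open>The differential equation forces every power of \<open>X\<^sup>2 + m\<close> to divide the solution: dividing
  out \<open>(X\<^sup>2 + m) ^ r\<close> leaves a quotient \<open>S\<close> such that \<open>X * S\<close> is divisible by \<open>X\<^sup>2 + m\<close>.\<close>

lemma poly_ode_solution_zero:
  fixes q :: "'a::field_char_0 poly" and m :: 'a
  defines "X \<equiv> [:0, 1:]"
  defines "D \<equiv> X\<^sup>2 + [:m:]"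
  assumes ode: "D\<^sup>2 * pderiv q = smult l (X * (D + [:k:]) * q)"
    and "l \<noteq> 0" "m \<noteq> 0" "k \<noteq> 0"
  shows "q = 0"
proof (rule ccontr)
  assume "q \<noteq> 0"
  have D: "D = [:m, 0, 1:]" by (simp add: D_def X_def power2_eq_square)
  then have deg: "degree D = 2" and D0: "D \<noteq> 0" by simp_all
  have "D ^ r dvd q" for r
  proof (induction r)
    case (Suc r)
    then obtain S where S: "q = D ^ r * S" by (elim dvdE)
    define H where "H = smult (of_nat r) (pderiv D)"
    \<comment> \<open>The extra factor \<open>D\<close> avoids the exponent \<open>r - 1\<close>, so
      \<open>D ^ r\<close> can be cancelled later for every \<open>r\<close>, 0 included.\<close>
    have "D * pderiv (D ^ r) = D ^ r * H"
    proof (cases r)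
      case (Suc n)
      have "D * pderiv (D ^ Suc n) = D * (smult (of_nat (Suc n)) (D ^ n) * pderiv D)"
        by (simp only: pderiv_power_Suc)
      also have "\<dots> = D ^ Suc n * smult (of_nat (Suc n)) (pderiv D)"
        by (simp add: mult.assoc del: of_nat_Suc)
      finally show ?thesis by (simp only: Suc H_def)
    qed (simp add: H_def)
    moreover have "D * pderiv q = S * (D * pderiv (D ^ r)) + D ^ r * (D * pderiv S)"
      unfolding S pderiv_mult by (simp add: algebra_simps)
    ultimately have "D * pderiv q = D ^ r * (H * S + D * pderiv S)"
      by (simp add: algebra_simps)
    then have "D ^ r * (D * (H * S + D * pderiv S)) = D\<^sup>2 * pderiv q"
      by (simp add: power2_eq_square mult.assoc mult.left_commute)
    also have "\<dots> = D ^ r * smult l (X * (D + [:k:]) * S)"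
      unfolding ode by (simp add: S mult.left_commute)
    finally have "D * (H * S + D * pderiv S) = smult l (X * (D + [:k:]) * S)"
      using D0 by (metis mult_left_cancel power_not_zero)
    \<comment> \<open>Modulo \<open>D\<close>, only the term with \<open>k\<close> survives.\<close>
    then have "smult (l * k) (X * S) = D * (H * S + D * pderiv S - smult l (X * S))"
      by (simp add: algebra_simps smult_add_right)
    then have "D dvd smult (l * k) (X * S)" by (metis dvd_triv_left)
    then have "D dvd X * S" using \<open>l \<noteq> 0\<close> \<open>k \<noteq> 0\<close> by (simp add: dvd_smult_iff)
    \<comment> \<open>\<open>X\<close> is invertible modulo \<open>D\<close> because
      \<open>D - X\<^sup>2\<close> is the nonzero constant \<open>m\<close>; this combination
      eliminates \<open>X\<close>.\<close>
    then have "D dvd D * S - X * (X * S)" by (metis dvd_diff dvd_mult dvd_triv_left)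
    also have "D * S - X * (X * S) = smult m S"
      by (simp add: D_def power2_eq_square algebra_simps)
    finally have "D dvd S" using \<open>m \<noteq> 0\<close> by (simp add: dvd_smult_iff)
    then show ?case by (simp add: S mult_dvd_mono mult.commute)
  qed simp
  \<comment> \<open>The divisor \<open>D ^ Suc (degree q)\<close> has degree
    \<open>2 * Suc (degree q)\<close>, which exceeds \<open>degree q\<close>.\<close>
  from dvd_imp_degree_le[OF this[of "Suc (degree q)"] \<open>q \<noteq> 0\<close>] show False
    using D0 by (simp add: degree_power_eq deg del: power_Suc)
qed

text \<open>On the line \<open>x = 1\<close> the power would be a polynomial \<open>q\<close> in
  \<open>y\<close>. There it equals \<open>exp (l / 2 * (ln D - exp 1 / D))\<close> with
  \<open>D = y\<^sup>2 + exp 1\<close>; differentiating gives the equation that forces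
  \<open>q = 0\<close>, although the exponential is positive.\<close>

lemma exp_norm_powr_not_polynomial:
  fixes l :: real
  assumes "l > 0"
  shows "\<not> real_polynomial_function (\<lambda>(x, y). exp_norm (x, y) powr l)"
proof
  assume "real_polynomial_function (\<lambda>(x, y). exp_norm (x, y) powr l)"
  moreover have "polynomial_function (\<lambda>y::real. (1::real, y))"
    using polynomial_function_add[OF polynomial_function_const[of "(1, 0) :: real \<times> real"]
        polynomial_function_mult[OF polynomial_function_id polynomial_function_const[of "(0, 1) :: real \<times> real"]]]
    by simp
  ultimately have "real_polynomial_function ((\<lambda>(x, y). exp_norm (x, y) powr l) \<circ> (\<lambda>y. (1, y)))"
    by (intro real_polynomial_function_compose)
  then obtain a n where a: "(\<lambda>y. exp_norm (1, y) powr l) = (\<lambda>y. \<Sum>i\<le>n. a i * y ^ i)"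
    by (auto simp: real_polynomial_function_iff_sum o_def)
  define q where "q = (\<Sum>i\<le>n. monom (a i) i)"
  have q: "poly q y = exp_norm (1, y) powr l" for y
    using fun_cong[OF a, of y] by (simp add: q_def poly_sum poly_monom)
  define D where "D y = y\<^sup>2 + exp 1" for y :: real
  have D: "D y > 0" for y by (simp add: D_def add_nonneg_pos)
  have q': "poly q y = exp (l / 2 * (ln (D y) - exp 1 / D y))" for y
  proof -
    have "gauge_quad (1, y) = D y" by (simp add: gauge_quad_def D_def)
    then have "exp_norm (1, y) = sqrt (exp (ln (D y) - exp 1 / D y))"
      using D[of y] by (simp add: exp_norm_def exp_diff exp_minus divide_inverse)
    also have "\<dots> = exp ((ln (D y) - exp 1 / D y) / 2)"
      by (rule real_sqrt_unique) (simp_all add: exp_double[symmetric])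
    finally show ?thesis by (simp add: q powr_def)
  qed
  have ode: "(D y)\<^sup>2 * poly (pderiv q) y = l * (y * (D y + exp 1) * poly q y)" for y
  proof -
    have dD: "(D has_real_derivative 2 * y) (at y)"
      unfolding D_def by (rule derivative_eq_intros refl | simp)+
    have "((\<lambda>y. ln (D y) - exp 1 / D y) has_real_derivative
        2 * y * (D y + exp 1) / (D y)\<^sup>2) (at y)"
      by (rule derivative_eq_intros dD refl D | use D[of y] in \<open>simp add: field_simps power2_eq_square\<close>)+
    then have "((\<lambda>y. exp (l / 2 * (ln (D y) - exp 1 / D y))) has_real_derivative
        poly q y * (l / 2 * (2 * y * (D y + exp 1) / (D y)\<^sup>2))) (at y)"
      unfolding q' by (intro DERIV_fun_exp DERIV_cmult)
    then have "(poly q has_real_derivative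
        poly q y * (l / 2 * (2 * y * (D y + exp 1) / (D y)\<^sup>2))) (at y)"
      by (simp only: q'[abs_def])
    then have "poly (pderiv q) y = poly q y * (l / 2 * (2 * y * (D y + exp 1) / (D y)\<^sup>2))"
      using poly_DERIV DERIV_unique by blast
    then show ?thesis using D[of y] by simp
  qed
  have "q = 0"
  \<comment> \<open>Here \<open>m\<close> and \<open>k\<close> are both \<open>exp 1\<close>:
    \<open>m\<close> comes from \<open>D\<close> and \<open>k\<close> from differentiating
    \<open>exp 1 / D\<close>.\<close>
  proof (rule poly_ode_solution_zero)
    show "([:0, 1:]\<^sup>2 + [:exp 1:])\<^sup>2 * pderiv q
        = smult l ([:0, 1:] * ([:0, 1:]\<^sup>2 + [:exp 1:] + [:exp 1:]) * q)"
      using ode[unfolded D_def]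
      unfolding poly_eq_poly_eq_iff[symmetric] fun_eq_iff by simp
  qed (use assms in auto)
  then show False using q'[of 0] by simp
qed

theorem mainTheorem4:
  "\<exists>N :: real \<times> real \<Rightarrow> real.
     absolute_norm N \<and> normalized_norm N \<and>
     poly_numerical_index 3 N = 0 \<and>
     (\<forall>l::real. l > 0 \<longrightarrow> \<not> real_polynomial_function (\<lambda>(x, y). N (x, y) powr l))"
proof (intro exI[of _ exp_norm] conjI allI impI)
  show "absolute_norm exp_norm"
    by (simp add: absolute_norm_def is_norm_exp_norm exp_norm_def gauge_quad_def)
  show "normalized_norm exp_norm"
    by (simp add: normalized_norm_def is_norm_exp_norm exp_norm_def gauge_quad_def flip: exp_add)
qed (fact poly_numerical_index_exp_norm exp_norm_powr_not_polynomial)+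

end
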